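(* Let $\mathcal{C}$ be a convex curve of affine length $\Lambda(\mathcal{C})$ whose affine curvature satisfies $\kappa\ge k_0$ for a constant $k_0$. Then any triangle $\triangle p_1p_2p_3$ with vertices on $\mathcal{C}$ satisfies $$\operatorname{Area}(\triangle p_1p_2p_3)<\bar A_{k_0}(\Lambda(\mathcal{C})).$$
   Context: For $v,w\in\mathbb{R}^2$ put $v\wedge w=v_1w_2-v_2w_1$. A $C^3$ curve $c$ has affine unit speed if $c'\wedge c''\equiv1$; its affine curvature $\kappa$ is defined by $c'''=-\kappa c'$. A convex curve is an embedded connected curve contained in the boundary of its convex hull; it is assumed to admit an affine unit speed $C^3$ parameterization, and $\Lambda(\mathcal{C})$ (finite) is the length of the parameter interval of an affine unit speed parameterization traversing $\mathcal{C}$ once. For $k\in\mathbb{R}$, $\bar A_k(s)=\dfrac{s-\mathbf{s}_k(s)}{2k}$ if $k\ne0$ and $\bar A_0(s)=\dfrac{s^3}{12}$, where $\mathbf{s}_k(s)=\sin(\sqrt k\,s)/\sqrt k$ for $k>0$ and $\mathbf{s}_k(s)=\sinh(\sqrt{|k|}\,s)/\sqrt{|k|}$ for $k<0$. *)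

theory Defs
  imports "HOL-Analysis.Analysis"
begin

definition wedge :: "real^2 \<Rightarrow> real^2 \<Rightarrow> real" where
  "wedge v w = v $ 1 * w $ 2 - v $ 2 * w $ 1"

text \<open>The derivatives are taken within the parameter interval, hence are one-sided at those
  endpoints that belong to it.\<close>

definition nth_deriv :: "real set \<Rightarrow> nat \<Rightarrow> (real \<Rightarrow> real^2) \<Rightarrow> real \<Rightarrow> real^2" where
  "nth_deriv I n c = ((\<lambda>f t. vector_derivative f (at t within I)) ^^ n) c"

definition C3_on :: "real set \<Rightarrow> (real \<Rightarrow> real^2) \<Rightarrow> bool" where
  "C3_on I c \<longleftrightarrow>
     (\<forall>n<3. \<forall>t\<in>I. nth_deriv I n c differentiable (at t within I)) \<and>
     continuous_on I (nth_deriv I 3 c)"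

definition affine_unit_speed :: "real set \<Rightarrow> (real \<Rightarrow> real^2) \<Rightarrow> bool" where
  "affine_unit_speed I c \<longleftrightarrow>
     C3_on I c \<and> (\<forall>t\<in>I. wedge (nth_deriv I 1 c t) (nth_deriv I 2 c t) = 1)"

text \<open>The number described here exists and is unique for curves of affine unit speed:
  differentiating \<open>c' \<and> c'' = 1\<close> gives \<open>c' \<and> c''' = 0\<close>, and \<open>c'\<close> does not vanish.\<close>

definition affine_curvature :: "real set \<Rightarrow> (real \<Rightarrow> real^2) \<Rightarrow> real \<Rightarrow> real" where
  "affine_curvature I c t = (THE k. nth_deriv I 3 c t = - k *\<^sub>R nth_deriv I 1 c t)"

text \<open>The second alternative is that of a closed curve, whose parameterization passes
  through its initial point a second time at the final parameter.\<close>

definition traverses_once :: "real set \<Rightarrow> (real \<Rightarrow> real^2) \<Rightarrow> (real^2) set \<Rightarrow> bool" where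
  "traverses_once I c C \<longleftrightarrow>
     c ` I = C \<and>
     (inj_on c I \<or> (\<exists>a b. I = {a..b} \<and> c a = c b \<and> inj_on c {a..<b}))"

text \<open>The parameter interval may be open, half-open or closed; it is bounded because the
  affine length is finite.\<close>

definition affine_unit_speed_param ::
    "real set \<Rightarrow> (real \<Rightarrow> real^2) \<Rightarrow> (real^2) set \<Rightarrow> bool" where
  "affine_unit_speed_param I c C \<longleftrightarrow>
     is_interval I \<and> bounded I \<and> interior I \<noteq> {} \<and>
     affine_unit_speed I c \<and> traverses_once I c C"

text \<open>An embedded connected curve is a homeomorphic copy of an interval or of a circle.\<close>

definition embedded_connected_curve :: "(real^2) set \<Rightarrow> bool" where
  "embedded_connected_curve C \<longleftrightarrow>
     (\<exists>J::real set. is_interval J \<and> interior J \<noteq> {} \<and> C homeomorphic J) \<or>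
     C homeomorphic sphere (0::real^2) 1"

definition convex_curve :: "(real^2) set \<Rightarrow> bool" where
  "convex_curve C \<longleftrightarrow>
     embedded_connected_curve C \<and> C \<subseteq> frontier (convex hull C) \<and>
     (\<exists>I c. affine_unit_speed_param I c C)"

text \<open>The value at \<open>k = 0\<close> is the limit for \<open>k \<rightarrow> 0\<close>; it is not used by \<open>A_bar\<close>.\<close>

definition s_fun :: "real \<Rightarrow> real \<Rightarrow> real" where
  "s_fun k s =
     (if k > 0 then sin (sqrt k * s) / sqrt k
      else if k < 0 then sinh (sqrt \<bar>k\<bar> * s) / sqrt \<bar>k\<bar>
      else s)"

definition A_bar :: "real \<Rightarrow> real \<Rightarrow> real" where
  "A_bar k s = (if k = 0 then s ^ 3 / 12 else (s - s_fun k s) / (2 * k))"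

end

theory Submission
  imports Defs
begin

text \<open>The triangle with vertices at the parameters \<open>t1 < t2 < t3\<close> is what remains of the cap
  between the arc and its chord over \<open>[t1, t3]\<close> after the two caps over \<open>[t1, t2]\<close> and
  \<open>[t2, t3]\<close> are cut off. The caps have positive area, so it suffices to bound the area of one
  cap over an interval of length \<open>l\<close> by \<open>A_bar k0 l\<close>, which increases with \<open>l\<close>. To avoid
  plane regions, the area of a cap is defined as the integral of \<open>(c - c a) \<and> c' / 2\<close>; the
  decomposition (\<open>cap_area_split\<close>) then is an identity of integrals.

  Convexity enters through \<open>tangent_supports\<close>: the whole curve lies to the left of each tangent,
  that is, \<open>c'(t) \<and> (c(s) - c(t)) \<ge> 0\<close>. Hence the integrand of the cap area is positive, and the
  chords from a fixed point turn to the left (\<open>chords_turn_left\<close>), which makes the signed area of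
  the triangle nonnegative.

  The bound for a cap (\<open>cap_area_le_A_bar\<close>) is a comparison of differential equations. Because
  \<open>c''' = - \<kappa> c'\<close> and \<open>c' \<and> c'' = 1\<close>, the integrand \<open>u = (c - c a) \<and> c' / 2\<close> solves
  \<open>u'' + \<kappa> u = 1/2\<close> with \<open>u(a) = u'(a) = 0\<close>; the derivative of \<open>A_bar k0\<close> solves the same
  initial value problem with \<open>k0\<close> in place of \<open>\<kappa>\<close> and \<open>0\<close> in place of \<open>a\<close>. The difference of
  the two areas is the integral of \<open>- (\<kappa> - k0) u\<close> against the Green kernel of the third-order
  equation that the area satisfies. For \<open>k0 > 0\<close> this kernel is
  \<open>(1 - cos (sqrt k0 * s)) / k0\<close>, which is nonnegative for every \<open>s\<close>, whereas the kernel
  \<open>s_fun k0\<close> of the second-order equation for the integrands changes sign. So the areas can be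
  compared over intervals of any length, although the integrands can be compared pointwise only
  up to the first zero of \<open>s_fun k0\<close>.\<close>

section \<open>Wedge products and supporting hyperplanes\<close>

interpretation wedge: bounded_bilinear wedge
proof
  fix a a' b b' :: "real^2" and r :: real
  show "wedge (a + a') b = wedge a b + wedge a' b" by (simp add: wedge_def algebra_simps)
  show "wedge a (b + b') = wedge a b + wedge a b'" by (simp add: wedge_def algebra_simps)
  show "wedge (r *\<^sub>R a) b = r *\<^sub>R wedge a b" by (simp add: wedge_def algebra_simps)
  show "wedge a (r *\<^sub>R b) = r *\<^sub>R wedge a b" by (simp add: wedge_def algebra_simps)
  have "norm (wedge v w) \<le> norm v * norm w * 2" for v w :: "real^2"
  proof -
    have "\<bar>v $ i * w $ j\<bar> \<le> norm v * norm w" for i j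
      unfolding abs_mult by (intro mult_mono component_le_norm_cart) auto
    from this[of 1 2] this[of 2 1] show ?thesis by (simp add: wedge_def)
  qed
  then show "\<exists>K. \<forall>v w. norm (wedge v w) \<le> norm v * norm w * K" by blast
qed

lemma wedge_self [simp]: "wedge v v = 0"
  by (simp add: wedge_def)

text \<open>Cramer's rule in the basis \<open>v, w\<close>.\<close>

lemma wedge_expansion:
  assumes "wedge v w = 1"
  shows "x = wedge x w *\<^sub>R v + wedge v x *\<^sub>R w"
proof -
  have "x $ 1 * wedge v w = (wedge x w *\<^sub>R v + wedge v x *\<^sub>R w) $ 1"
    by (simp add: wedge_def algebra_simps)
  moreover have "x $ 2 * wedge v w = (wedge x w *\<^sub>R v + wedge v x *\<^sub>R w) $ 2"
    by (simp add: wedge_def algebra_simps)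
  ultimately show ?thesis by (simp add: assms vec_eq_iff forall_2)
qed

lemma DERIV_wedge:
  assumes "(f has_vector_derivative f') (at t)" "(g has_vector_derivative g') (at t)"
  shows "((\<lambda>r. wedge (f r) (g r)) has_real_derivative wedge (f t) g' + wedge f' (g t)) (at t)"
  using wedge.has_vector_derivative[OF assms]
  by (simp add: has_real_derivative_iff_has_vector_derivative)

lemma measure_triangle_eq_wedge:
  "measure lborel (convex hull {p, q, r}) = \<bar>wedge (q - p) (r - p)\<bar> / 2"
  by (simp add: content_triangle wedge_def algebra_simps)

text \<open>A convex set with empty interior lies in a hyperplane, which then serves as the supporting one;
  otherwise the interior is the relative interior.\<close>

lemma supporting_hyperplane_frontier:
  fixes S :: "'a::euclidean_space set"
  assumes "convex S" "x \<in> closure S" "x \<notin> interior S"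
  obtains a where "a \<noteq> 0" "\<forall>y\<in>closure S. a \<bullet> x \<le> a \<bullet> y"
proof (cases "interior S = {}")
  case True
  then obtain a b where a: "a \<noteq> 0" and "S \<subseteq> {y. a \<bullet> y = b}"
    using empty_interior_subset_hyperplane[OF \<open>convex S\<close>] by blast
  then have "\<forall>y\<in>closure S. a \<bullet> y = b"
    using closure_minimal[OF _ closed_hyperplane] by blast
  then show thesis using assms(2) by (intro that[OF a]) simp
next
  case False
  then have "x \<notin> rel_interior S" using assms(3) by (simp add: rel_interior_nonempty_interior)
  then obtain a where "a \<noteq> 0" "\<And>y. y \<in> closure S \<Longrightarrow> a \<bullet> x \<le> a \<bullet> y"
    using supporting_hyperplane_relative_frontier[OF assms(1,2)] by metis
  then show thesis by (intro that) auto
qed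

section \<open>The model functions\<close>

text \<open>The solution of \<open>y''' + k y' = 0\<close> with \<open>y(0) = y'(0) = 0\<close> and \<open>y''(0) = 1\<close>: the Green kernel
  of the third-order equation that the area of a cap satisfies.\<close>

definition kernel :: "real \<Rightarrow> real \<Rightarrow> real" where
  "kernel k s =
     (if k > 0 then (1 - cos (sqrt k * s)) / k
      else if k < 0 then (1 - cosh (sqrt \<bar>k\<bar> * s)) / k
      else s\<^sup>2 / 2)"

lemma kernel_nonneg: "0 \<le> kernel k s"
  using cosh_real_ge_1[of "sqrt \<bar>k\<bar> * s"] by (auto simp: kernel_def divide_nonpos_neg)

lemma model_functions_0 [simp]: "kernel k 0 = 0" "s_fun k 0 = 0" "A_bar k 0 = 0"
  by (auto simp: kernel_def s_fun_def A_bar_def)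

lemma DERIV_kernel: "(kernel k has_real_derivative s_fun k s) (at s)"
proof -
  consider "k > 0" | "k < 0" | "k = 0" by linarith
  then show ?thesis
  proof cases
    case 1
    then have eq: "kernel k = (\<lambda>s. (1 - cos (sqrt k * s)) / k)" by (auto simp: kernel_def)
    show ?thesis unfolding eq using 1
      by (auto intro!: derivative_eq_intros simp: s_fun_def field_simps)
  next
    case 2
    then have eq: "kernel k = (\<lambda>s. (1 - cosh (sqrt \<bar>k\<bar> * s)) / k)" by (auto simp: kernel_def)
    define q where "q = sqrt \<bar>k\<bar>"
    have "k = - (q * q)" "q \<noteq> 0" using 2 by (simp_all add: q_def)
    then have "- (sinh (q * s) * q) / k = sinh (q * s) / q" by simp
    then have "- (sinh (sqrt \<bar>k\<bar> * s) * sqrt \<bar>k\<bar>) / k = sinh (sqrt \<bar>k\<bar> * s) / sqrt \<bar>k\<bar>"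
      by (simp only: q_def)
    then show ?thesis unfolding eq using 2
      by (auto intro!: derivative_eq_intros simp: s_fun_def)
  next
    case 3
    then have eq: "kernel k = (\<lambda>s. s\<^sup>2 / 2)" by (auto simp: kernel_def)
    show ?thesis unfolding eq using 3 by (auto intro!: derivative_eq_intros simp: s_fun_def)
  qed
qed

lemma DERIV_s_fun: "(s_fun k has_real_derivative 1 - k * kernel k s) (at s)"
proof -
  consider "k > 0" | "k < 0" | "k = 0" by linarith
  then show ?thesis
  proof cases
    case 1
    then have eq: "s_fun k = (\<lambda>s. sin (sqrt k * s) / sqrt k)" by (auto simp: s_fun_def)
    have "cos (sqrt k * s) * sqrt k * sqrt k / k = 1 - k * kernel k s"
      using 1 by (simp add: kernel_def mult.assoc)
    then show ?thesis unfolding eq using 1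
      by (auto intro!: derivative_eq_intros)
  next
    case 2
    then have eq: "s_fun k = (\<lambda>s. sinh (sqrt \<bar>k\<bar> * s) / sqrt \<bar>k\<bar>)" by (auto simp: s_fun_def)
    have "sqrt \<bar>k\<bar> * sqrt \<bar>k\<bar> = - k" using 2 by simp
    then have "cosh (sqrt \<bar>k\<bar> * s) * sqrt \<bar>k\<bar> * sqrt \<bar>k\<bar> / k = k * kernel k s - 1"
      using 2 by (simp add: kernel_def mult.assoc)
    then show ?thesis unfolding eq using 2
      by (auto intro!: derivative_eq_intros)
  next
    case 3
    then have eq: "s_fun k = (\<lambda>s. s)" by (auto simp: s_fun_def)
    show ?thesis unfolding eq using 3 by simp
  qed
qed

lemma DERIV_A_bar: "(A_bar k has_real_derivative kernel k s / 2) (at s)"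
proof (cases "k = 0")
  case True
  then have eq: "A_bar k = (\<lambda>s. s ^ 3 / 12)" by (auto simp: A_bar_def)
  show ?thesis unfolding eq using True
    by (auto intro!: derivative_eq_intros simp: kernel_def)
next
  case False
  then have eq: "A_bar k = (\<lambda>s. (s - s_fun k s) / (2 * k))" by (auto simp: A_bar_def)
  show ?thesis unfolding eq using False
    by (auto intro!: derivative_eq_intros DERIV_s_fun)
qed

lemma A_bar_mono:
  assumes "a \<le> b" shows "A_bar k a \<le> A_bar k b"
  by (rule DERIV_nonneg_imp_nondecreasing[OF assms], rule exI, rule conjI, rule DERIV_A_bar)
     (simp add: kernel_nonneg)

section \<open>Convex arcs of affine unit speed\<close>

text \<open>The differential equations are required in the interior of the parameter interval only; what
  happens at the endpoints is controlled by continuity. The condition \<open>embedded\<close> leaves room for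
  closed curves, whose two endpoints are the same point of the plane.\<close>

locale convex_affine_arc =
  fixes I :: "real set" and c c1 c2 :: "real \<Rightarrow> real^2" and \<kappa> :: "real \<Rightarrow> real"
  assumes interval: "is_interval I"
    and cont: "continuous_on I c" "continuous_on I c1" "continuous_on I c2"
    and deriv:
      "t \<in> interior I \<Longrightarrow> (c has_vector_derivative c1 t) (at t)"
      "t \<in> interior I \<Longrightarrow> (c1 has_vector_derivative c2 t) (at t)"
      "t \<in> interior I \<Longrightarrow> (c2 has_vector_derivative - \<kappa> t *\<^sub>R c1 t) (at t)"
    and unit_speed: "t \<in> interior I \<Longrightarrow> wedge (c1 t) (c2 t) = 1"
    and embedded: "\<lbrakk>s \<in> I; t \<in> interior I; s \<noteq> t\<rbrakk> \<Longrightarrow> c s \<noteq> c t"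
    and on_hull: "c ` I \<subseteq> frontier (convex hull (c ` I))"
begin

lemma Icc_subset: "a \<in> I \<Longrightarrow> b \<in> I \<Longrightarrow> {a..b} \<subseteq> I"
  using mem_is_interval_1_I[OF interval] by (meson atLeastAtMost_iff subsetI)

lemma Ioo_subset_interior:
  assumes "a \<in> I" "b \<in> I" shows "{a<..<b} \<subseteq> interior I"
  by (rule interior_maximal) (use Icc_subset[OF assms] in auto)

lemma interior_nbhd:
  assumes "t \<in> interior I"
  obtains e where "e > 0" "\<And>r. \<bar>t - r\<bar> < e \<Longrightarrow> r \<in> interior I"
proof -
  obtain e where "e > 0" "ball t e \<subseteq> interior I"
    using open_interior assms open_contains_ball by blast
  then show thesis by (intro that[of e]) (auto simp: dist_real_def subset_iff)
qed

lemma interior_in: "t \<in> interior I \<Longrightarrow> t \<in> I"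
  using interior_subset by blast

text \<open>A supporting line of the hull at \<open>c t\<close> must be the tangent, because a linear form that is
  minimal at \<open>c t\<close> along the curve annihilates \<open>c'\<close>. It cannot be negative on \<open>c''\<close>, and
  since \<open>c' \<and> c'' = 1\<close> this determines the side on which the curve lies.\<close>

lemma tangent_supports:
  assumes t: "t \<in> interior I" and s: "s \<in> I"
  shows "0 \<le> wedge (c1 t) (c s - c t)"
proof -
  let ?H = "convex hull (c ` I)"
  have "c t \<in> closure ?H" "c t \<notin> interior ?H"
    using on_hull interior_in[OF t] by (auto simp: frontier_def)
  then obtain a where a: "a \<noteq> 0" and "\<forall>y\<in>closure ?H. a \<bullet> c t \<le> a \<bullet> y"
    using supporting_hyperplane_frontier[OF convex_convex_hull] by blast
  then have min: "a \<bullet> c t \<le> a \<bullet> c r" if "r \<in> I" for r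
    using that by (meson closure_subset hull_subset imageI subsetD)
  obtain e where e: "e > 0" "\<And>r. \<bar>t - r\<bar> < e \<Longrightarrow> r \<in> interior I"
    using interior_nbhd[OF t] by blast
  have d1: "((\<lambda>r. a \<bullet> c r) has_real_derivative a \<bullet> c1 r) (at r)"
    and d2: "((\<lambda>r. a \<bullet> c1 r) has_real_derivative a \<bullet> c2 r) (at r)" if "r \<in> interior I" for r
    using bounded_linear.has_vector_derivative[OF bounded_linear_inner_right, OF deriv(1)[OF that], of a]
          bounded_linear.has_vector_derivative[OF bounded_linear_inner_right, OF deriv(2)[OF that], of a]
    by (auto simp: has_real_derivative_iff_has_vector_derivative)
  have ac1: "a \<bullet> c1 t = 0"
    by (rule DERIV_local_min[OF d1[OF t] e(1)]) (use e(2) min interior_in in blast)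
  have ac2: "0 \<le> a \<bullet> c2 t"
  proof (rule ccontr)
    assume "\<not> 0 \<le> a \<bullet> c2 t"
    then obtain d where d: "d > 0" "\<And>h. 0 < h \<Longrightarrow> h < d \<Longrightarrow> a \<bullet> c1 (t + h) < 0"
      using DERIV_neg_dec_right[OF d2[OF t]] ac1 by auto
    define h where "h = min d e / 2"
    have h: "0 < h" "h < d" "h < e" using d e by (auto simp: h_def)
    have int: "r \<in> interior I" if "t \<le> r" "r \<le> t + h" for r
      using that h e by auto
    have "a \<bullet> c (t + h) < a \<bullet> c t"
    proof (rule DERIV_neg_imp_decreasing_open[where f = "\<lambda>r. a \<bullet> c r"])
      show "\<exists>y. ((\<lambda>r. a \<bullet> c r) has_real_derivative y) (at r) \<and> y < 0"
        if "t < r" "r < t + h" for r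
        using d1[OF int[of r]] d(2)[of "r - t"] that h by auto
      show "continuous_on {t..t + h} (\<lambda>r. a \<bullet> c r)"
        by (intro continuous_intros continuous_on_subset[OF cont(1)]) (use int interior_in in auto)
    qed (use h in simp)
    with min[OF interior_in[OF int[of "t + h"]]] h show False by simp
  qed
  \<comment> \<open>Since the linear form \<open>a\<close> annihilates \<open>c'\<close>, it is a multiple of \<open>wedge c'\<close>.\<close>
  have form: "a \<bullet> x = wedge (c1 t) x * (a \<bullet> c2 t)" for x
    by (subst wedge_expansion[OF unit_speed[OF t], of x]) (simp add: inner_add_right ac1)
  with a have "a \<bullet> c2 t \<noteq> 0" by (metis inner_eq_zero_iff mult_zero_right)
  with ac2 have "a \<bullet> c2 t > 0" by simp
  moreover have "0 \<le> wedge (c1 t) (c s - c t) * (a \<bullet> c2 t)"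
    using min[OF s] form[of "c s - c t"] by (simp add: inner_diff_right)
  ultimately show ?thesis by (simp add: zero_le_mult_iff)
qed

text \<open>If a tangent met the curve again at \<open>c s\<close>, the nonnegative function
  \<open>r \<mapsto> c'(r) \<and> (c s - c r)\<close> would have a minimum at \<open>t\<close>. Its derivative
  \<open>c''(t) \<and> (c s - c t)\<close> would vanish as well, and a vector whose wedge products with both \<open>c'\<close>
  and \<open>c''\<close> are zero is zero.\<close>

lemma tangent_supports_strictly:
  assumes t: "t \<in> interior I" and s: "s \<in> I" and "s \<noteq> t"
  shows "0 < wedge (c1 t) (c s - c t)"
proof (rule ccontr)
  assume "\<not> ?thesis"
  with tangent_supports[OF t s] have 0: "wedge (c1 t) (c s - c t) = 0" by simp
  obtain e where e: "e > 0" "\<And>r. \<bar>t - r\<bar> < e \<Longrightarrow> r \<in> interior I"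
    using interior_nbhd[OF t] by blast
  have "((\<lambda>r. c s - c r) has_vector_derivative 0 - c1 t) (at t)"
    by (intro derivative_intros deriv t)
  from DERIV_wedge[OF deriv(2)[OF t] this]
  have "((\<lambda>r. wedge (c1 r) (c s - c r)) has_real_derivative wedge (c2 t) (c s - c t)) (at t)"
    by (simp add: wedge.minus_right)
  then have "wedge (c2 t) (c s - c t) = 0"
    by (rule DERIV_local_min[OF _ e(1)]) (use 0 tangent_supports[OF e(2) s] in auto)
  then have "wedge (c s - c t) (c2 t) = 0" by (simp add: wedge_def algebra_simps)
  then have "c s - c t = 0"
    using wedge_expansion[OF unit_speed[OF t], of "c s - c t"] 0 by simp
  with embedded[OF s t \<open>s \<noteq> t\<close>] show False by simp
qed

text \<open>Seen from \<open>c t1\<close>, the curve stays strictly to the left of the tangent there and its polar angle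
  increases. The quotient \<open>R\<close> below stands in for the angle: it is an increasing affine function
  of minus the cotangent of the angle from the tangent to the chord, and it vanishes at \<open>t2\<close>.\<close>

lemma chords_turn_left_interior:
  assumes ord: "t1 < t2" "t2 \<le> t3" and t1: "t1 \<in> interior I" and t3: "t3 \<in> interior I"
  shows "0 \<le> wedge (c t2 - c t1) (c t3 - c t1)"
proof -
  have int: "r \<in> interior I" if "t1 \<le> r" "r \<le> t3" for r
    using that t1 t3 Ioo_subset_interior[of t1 t3] interior_in by (cases "r = t1 \<or> r = t3") auto
  define h where "h r = wedge (c1 t1) (c r - c t1)" for r
  define R where "R r = wedge (c t2 - c t1) (c r - c t1) / h r" for r
  have pos: "0 < h r" if "t1 < r" "r \<le> t3" for r
    unfolding h_def using that by (intro tangent_supports_strictly t1 interior_in int) auto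
  have dR: "(R has_real_derivative h t2 * wedge (c r - c t1) (c1 r) / (h r)\<^sup>2) (at r)"
    if "t2 \<le> r" "r \<le> t3" for r
  proof -
    have "((\<lambda>r. c r - c t1) has_vector_derivative c1 r - 0) (at r)"
      by (intro derivative_intros deriv int) (use that ord in auto)
    from DERIV_wedge[OF has_vector_derivative_const this]
    have d: "((\<lambda>r. wedge v (c r - c t1)) has_real_derivative wedge v (c1 r)) (at r)" for v
      by (simp add: wedge.zero_left)
    have "h r \<noteq> 0" using pos[of r] that ord by auto
    have "(R has_real_derivative
        (wedge (c t2 - c t1) (c1 r) * h r - wedge (c t2 - c t1) (c r - c t1) * wedge (c1 t1) (c1 r))
          / (h r * h r)) (at r)"
      unfolding R_def h_def using \<open>h r \<noteq> 0\<close> by (intro DERIV_divide d) (simp add: h_def)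
    moreover have "wedge (c t2 - c t1) (c1 r) * h r
        - wedge (c t2 - c t1) (c r - c t1) * wedge (c1 t1) (c1 r) = h t2 * wedge (c r - c t1) (c1 r)"
      by (simp add: h_def wedge_def algebra_simps)
    ultimately show ?thesis by (simp add: power2_eq_square)
  qed
  have "R t2 \<le> R t3"
  proof (rule DERIV_nonneg_imp_nondecreasing[OF ord(2)])
    fix r assume r: "t2 \<le> r" "r \<le> t3"
    have "0 \<le> wedge (c1 r) (c t1 - c r)"
      using r ord by (intro tangent_supports int interior_in t1) auto
    then have "0 \<le> wedge (c r - c t1) (c1 r)" by (simp add: wedge_def algebra_simps)
    then show "\<exists>y. (R has_real_derivative y) (at r) \<and> 0 \<le> y"
      using dR[OF r] pos[of t2] ord
      by (intro exI[of _ "h t2 * wedge (c r - c t1) (c1 r) / (h r)\<^sup>2"]) simp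
  qed
  then have "0 \<le> R t3" by (simp add: R_def)
  with pos[of t3] ord show ?thesis by (simp add: R_def zero_le_divide_iff)
qed

text \<open>At an endpoint of the parameter interval there is no two-sided tangent to start from, so the
  outer two parameters are first moved into the interior.\<close>

lemma chords_turn_left:
  assumes ord: "t1 < t2" "t2 < t3" and t1: "t1 \<in> I" and t3: "t3 \<in> I"
  shows "0 \<le> wedge (c t2 - c t1) (c t3 - c t1)"
proof -
  define g where "g x = wedge (c t2 - c (t1 + x)) (c (t3 - x) - c (t1 + x))" for x
  define m where "m = min (t2 - t1) (t3 - t2)"
  have m: "m > 0" "t1 + m \<le> t2" "t2 \<le> t3 - m" using ord by (auto simp: m_def)
  have "continuous_on {0..m} (\<lambda>x. c (t1 + x))" "continuous_on {0..m} (\<lambda>x. c (t3 - x))"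
    by (rule continuous_on_compose2[OF cont(1)];
        use Icc_subset[OF t1 t3] m in \<open>auto intro!: continuous_intros\<close>)+
  then have "continuous_on {0..m} g"
    unfolding g_def by (intro wedge.continuous_on continuous_intros)
  then have lim: "(g \<longlongrightarrow> g 0) (at 0 within {0..m})"
    using m by (simp add: continuous_on_def)
  have "\<forall>\<^sub>F x in at 0 within {0..m}. 0 \<le> g x"
  proof -
    have "0 \<le> g x" if "0 < x" "x < m" for x
      unfolding g_def using that m Ioo_subset_interior[OF t1 t3]
      by (intro chords_turn_left_interior) auto
    then show ?thesis
      using m by (auto simp: eventually_at dist_real_def intro!: exI[of _ m])
  qed
  then have "0 \<le> g 0"
    using m by (intro tendsto_lowerbound[OF lim]) (auto simp: at_within_Icc_at_right)
  then show ?thesis by (simp add: g_def)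
qed

text \<open>The signed area enclosed by the arc over \<open>[a, b]\<close> and its chord, by Green's formula with
  origin \<open>c a\<close>; the chord passes through this origin and does not contribute.\<close>

definition cap_area :: "real \<Rightarrow> real \<Rightarrow> real" where
  "cap_area a b = integral {a..b} (\<lambda>t. wedge (c t - c a) (c1 t)) / 2"

lemma cap_density_continuous:
  assumes "a \<in> I" "b \<in> I"
  shows "continuous_on {a..b} (\<lambda>t. wedge (c t - v) (c1 t))"
  by (intro wedge.continuous_on continuous_intros cont[THEN continuous_on_subset]
      Icc_subset assms)

lemma cap_area_refl [simp]: "cap_area a a = 0"
  by (simp add: cap_area_def)

lemma
  assumes a: "a \<in> I" and b: "b \<in> I"
  shows cap_area_continuous: "continuous_on {a..b} (cap_area a)"
    and DERIV_cap_area: "\<And>t. \<lbrakk>a < t; t < b\<rbrakk> \<Longrightarrow>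
      (cap_area a has_real_derivative wedge (c t - c a) (c1 t) / 2) (at t)"
proof -
  have d: "(cap_area a has_real_derivative wedge (c t - c a) (c1 t) / 2) (at t within {a..b})"
    if "t \<in> {a..b}" for t
    unfolding cap_area_def
    by (intro DERIV_cdivide integral_has_real_derivative[OF cap_density_continuous] a b that)
  then show "continuous_on {a..b} (cap_area a)" by (intro DERIV_continuous_on)
  show "(cap_area a has_real_derivative wedge (c t - c a) (c1 t) / 2) (at t)"
    if "a < t" "t < b" for t
    using d[of t] that by (simp add: at_within_Icc_at)
qed

text \<open>Moving the base point from \<open>c t1\<close> to \<open>c t2\<close> on the second part of the arc changes the
  integrand by the wedge product of the constant vector \<open>c t2 - c t1\<close> with \<open>c'\<close>, which
  integrates to the triangle term.\<close>

lemma cap_area_split: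
  assumes ord: "t1 \<le> t2" "t2 \<le> t3" and t1: "t1 \<in> I" and t3: "t3 \<in> I"
  shows "cap_area t1 t3 = cap_area t1 t2 + cap_area t2 t3 + wedge (c t2 - c t1) (c t3 - c t1) / 2"
proof -
  have t2: "t2 \<in> I" using Icc_subset[OF t1 t3] ord by auto
  have "((\<lambda>t. wedge (c t2 - c t1) (c1 t)) has_integral
      wedge (c t2 - c t1) (c t3) - wedge (c t2 - c t1) (c t2)) {t2..t3}"
  proof (rule fundamental_theorem_of_calculus_interior[OF ord(2)])
    show "continuous_on {t2..t3} (\<lambda>t. wedge (c t2 - c t1) (c t))"
      by (intro wedge.continuous_on continuous_intros continuous_on_subset[OF cont(1)]
          Icc_subset t2 t3)
    show "((\<lambda>t. wedge (c t2 - c t1) (c t)) has_vector_derivative wedge (c t2 - c t1) (c1 t)) (at t)"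
      if "t \<in> {t2<..<t3}" for t
      using wedge.has_vector_derivative[OF has_vector_derivative_const deriv(1)]
        that Ioo_subset_interior[OF t2 t3] by (auto simp: wedge.zero_left)
  qed
  moreover have "((\<lambda>t. wedge (c t - c t2) (c1 t)) has_integral 2 * cap_area t2 t3) {t2..t3}"
    using integrable_continuous_real[OF cap_density_continuous[OF t2 t3]]
    by (simp add: cap_area_def integrable_integral)
  ultimately have "((\<lambda>t. wedge (c t - c t2) (c1 t) + wedge (c t2 - c t1) (c1 t)) has_integral
      2 * cap_area t2 t3 + (wedge (c t2 - c t1) (c t3) - wedge (c t2 - c t1) (c t2))) {t2..t3}"
    by (intro has_integral_add)
  moreover have "(\<lambda>t. wedge (c t - c t2) (c1 t) + wedge (c t2 - c t1) (c1 t))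
      = (\<lambda>t. wedge (c t - c t1) (c1 t))"
    by (simp add: fun_eq_iff wedge_def algebra_simps)
  ultimately have "integral {t2..t3} (\<lambda>t. wedge (c t - c t1) (c1 t))
      = 2 * cap_area t2 t3 + wedge (c t2 - c t1) (c t3 - c t2)"
    by (simp add: integral_unique wedge.diff_right)
  moreover have "integral {t1..t2} (\<lambda>t. wedge (c t - c t1) (c1 t))
      + integral {t2..t3} (\<lambda>t. wedge (c t - c t1) (c1 t))
      = integral {t1..t3} (\<lambda>t. wedge (c t - c t1) (c1 t))"
    by (intro Henstock_Kurzweil_Integration.integral_combine ord
        integrable_continuous_real cap_density_continuous t1 t3)
  ultimately have "cap_area t1 t3
      = cap_area t1 t2 + cap_area t2 t3 + wedge (c t2 - c t1) (c t3 - c t2) / 2"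
    by (simp add: cap_area_def)
  moreover have "wedge (c t2 - c t1) (c t3 - c t2) = wedge (c t2 - c t1) (c t3 - c t1)"
    by (simp add: wedge_def algebra_simps)
  ultimately show ?thesis by simp
qed

lemma cap_density_pos:
  assumes "a \<in> I" "t \<in> interior I" "a \<noteq> t"
  shows "0 < wedge (c t - c a) (c1 t)"
  using tangent_supports_strictly[OF assms(2,1,3)] by (simp add: wedge_def algebra_simps)

lemma cap_area_pos:
  assumes "a < b" and a: "a \<in> I" and b: "b \<in> I"
  shows "0 < cap_area a b"
proof -
  have "cap_area a a < cap_area a b"
  proof (rule DERIV_pos_imp_increasing_open[OF \<open>a < b\<close> _ cap_area_continuous[OF a b]])
    fix t assume t: "a < t" "t < b"
    then have "t \<in> interior I" using Ioo_subset_interior[OF a b] by auto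
    with t show "\<exists>y. (cap_area a has_real_derivative y) (at t) \<and> 0 < y"
      using DERIV_cap_area[OF a b t] cap_density_pos[OF a] by (intro exI conjI) auto
  qed
  then show ?thesis by simp
qed

text \<open>The function \<open>G\<close> below interpolates between the two sides: \<open>G a = A_bar k (b - a)\<close> and
  \<open>G b = cap_area a b\<close>. Its value at \<open>t\<close> is the area of the cap that results if the curve is
  followed up to \<open>t\<close> and is continued with constant curvature \<open>k\<close> from there to \<open>b\<close>. It
  decreases since its derivative is \<open>- (\<kappa> - k) u K\<close>, where \<open>K\<close> is the nonnegative kernel at
  \<open>b - t\<close>.\<close>

lemma cap_area_le_A_bar:
  assumes "a < b" and a: "a \<in> I" and b: "b \<in> I"
    and curv: "\<And>t. t \<in> interior I \<Longrightarrow> k \<le> \<kappa> t"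
  shows "cap_area a b \<le> A_bar k (b - a)"
proof -
  define u where "u t = wedge (c t - c a) (c1 t) / 2" for t
  define u' where "u' t = wedge (c t - c a) (c2 t) / 2" for t
  define G where "G t = u' t * kernel k (b - t) + u t * s_fun k (b - t)
    + cap_area a t + A_bar k (b - t)" for t
  have "G b \<le> G a"
  proof (rule DERIV_nonpos_imp_decreasing_open[where f = G])
    have cs: "continuous_on UNIV (kernel k)" "continuous_on UNIV (s_fun k)"
      "continuous_on UNIV (A_bar k)"
      by (auto intro!: DERIV_continuous_on DERIV_kernel DERIV_s_fun DERIV_A_bar)
    have "continuous_on {a..b} u" "continuous_on {a..b} u'"
      unfolding u_def u'_def
      by (intro continuous_intros wedge.continuous_on cont[THEN continuous_on_subset]
          Icc_subset a b; simp)+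
    then show "continuous_on {a..b} G"
      unfolding G_def
      by (intro continuous_intros cap_area_continuous a b cs[THEN continuous_on_compose2]) auto
  next
    fix t assume t: "a < t" "t < b"
    then have int: "t \<in> interior I" using Ioo_subset_interior[OF a b] by auto
    have dc: "((\<lambda>r. c r - c a) has_vector_derivative c1 t - 0) (at t)"
      by (intro derivative_intros deriv int)
    have du: "(u has_real_derivative u' t) (at t)"
      unfolding u_def u'_def using DERIV_cdivide[OF DERIV_wedge[OF dc deriv(2)[OF int]], of 2] by simp
    have du': "(u' has_real_derivative 1 / 2 - \<kappa> t * u t) (at t)"
      unfolding u'_def u_def
      using DERIV_cdivide[OF DERIV_wedge[OF dc deriv(3)[OF int]], of 2] unit_speed[OF int]
      by (simp add: wedge.scaleR_right wedge.minus_right diff_divide_distrib add_divide_distrib)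
    have reflected: "((\<lambda>t. f (b - t)) has_real_derivative - f') (at t)"
      if "(f has_real_derivative f') (at (b - t))" for f f'
    proof -
      have "((\<lambda>t. b - t) has_real_derivative - 1) (at t)"
        by (auto intro!: derivative_eq_intros)
      from DERIV_chain2[where g = "\<lambda>t. b - t", OF that this] show ?thesis by simp
    qed
    have "(G has_real_derivative
        (1 / 2 - \<kappa> t * u t) * kernel k (b - t) + - s_fun k (b - t) * u' t
        + (u' t * s_fun k (b - t) + - (1 - k * kernel k (b - t)) * u t)
        + u t + - (kernel k (b - t) / 2)) (at t)"
      unfolding G_def
      using DERIV_cap_area[OF a b t, folded u_def]
      by (intro DERIV_add DERIV_mult du du' reflected DERIV_kernel DERIV_s_fun DERIV_A_bar)
    moreover have "(1 / 2 - \<kappa> t * u t) * kernel k (b - t) + - s_fun k (b - t) * u' t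
        + (u' t * s_fun k (b - t) + - (1 - k * kernel k (b - t)) * u t)
        + u t + - (kernel k (b - t) / 2) = - ((\<kappa> t - k) * (u t * kernel k (b - t)))"
      by (simp add: algebra_simps)
    moreover have "0 \<le> (\<kappa> t - k) * (u t * kernel k (b - t))"
      using curv[OF int] cap_density_pos[OF a int] t
      by (intro mult_nonneg_nonneg kernel_nonneg) (auto simp: u_def)
    ultimately show "\<exists>y. (G has_real_derivative y) (at t) \<and> y \<le> 0" by force
  qed (use \<open>a < b\<close> in simp)
  moreover have "G a = A_bar k (b - a)" by (simp add: G_def u_def u'_def wedge.zero_left)
  moreover have "G b = cap_area a b" by (simp add: G_def)
  ultimately show ?thesis by simp
qed

lemma triangle_area_less_ordered:
  assumes ord: "t1 < t2" "t2 < t3" and t1: "t1 \<in> I" and t3: "t3 \<in> I"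
    and curv: "\<And>t. t \<in> interior I \<Longrightarrow> k \<le> \<kappa> t"
  shows "measure lborel (convex hull {c t1, c t2, c t3}) < A_bar k (t3 - t1)"
proof -
  have t2: "t2 \<in> I" using Icc_subset[OF t1 t3] ord by auto
  have "measure lborel (convex hull {c t1, c t2, c t3}) = wedge (c t2 - c t1) (c t3 - c t1) / 2"
    using chords_turn_left[OF ord t1 t3] by (simp add: measure_triangle_eq_wedge)
  also have "\<dots> = cap_area t1 t3 - cap_area t1 t2 - cap_area t2 t3"
    using cap_area_split[OF _ _ t1 t3, of t2] ord by simp
  also have "\<dots> < cap_area t1 t3"
    using cap_area_pos[OF ord(1) t1 t2] cap_area_pos[OF ord(2) t2 t3] by simp
  also have "\<dots> \<le> A_bar k (t3 - t1)"
    using cap_area_le_A_bar[OF _ t1 t3 curv] ord by simp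
  finally show ?thesis .
qed

text \<open>For a degenerate triangle the claim is the positivity of \<open>A_bar\<close>; this follows from the bound
  for any three distinct parameters, as an area is nonnegative.\<close>

lemma triangle_area_less:
  assumes "bounded I" "interior I \<noteq> {}"
    and t: "t1 \<in> I" "t2 \<in> I" "t3 \<in> I"
    and curv: "\<And>t. t \<in> interior I \<Longrightarrow> k \<le> \<kappa> t"
  shows "measure lborel (convex hull {c t1, c t2, c t3}) < A_bar k (measure lborel I)"
proof -
  have len: "b - a \<le> measure lborel I" if "a \<le> b" "a \<in> I" "b \<in> I" for a b
  proof -
    have "I \<in> sets borel" using interval by (simp add: real_interval_borel_measurable)
    moreover have "emeasure lborel I < \<infinity>" using \<open>bounded I\<close> by (rule emeasure_bounded_finite)
    ultimately have "measure lborel {a..b} \<le> measure lborel I"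
      using Icc_subset[OF that(2,3)] by (intro measure_mono_fmeasurable fmeasurableI) auto
    with \<open>a \<le> b\<close> show ?thesis by simp
  qed
  have ordered: "measure lborel (convex hull {c a, c b, c d}) < A_bar k (measure lborel I)"
    if "a < b" "b < d" "a \<in> I" "d \<in> I" for a b d
    using triangle_area_less_ordered[OF that curv] A_bar_mono[OF len[of a d], of k] that by simp
  have A_bar_pos: "0 < A_bar k (measure lborel I)"
  proof -
    obtain t where "t \<in> interior I" using \<open>interior I \<noteq> {}\<close> by blast
    then obtain e where e: "e > 0" "\<And>r. \<bar>t - r\<bar> < e \<Longrightarrow> r \<in> interior I"
      using interior_nbhd by blast
    have "t - e / 2 \<in> I" "t + e / 2 \<in> I" using e by (auto intro!: interior_in)
    then show ?thesis using ordered[of "t - e / 2" t "t + e / 2"] e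
      by (intro le_less_trans[OF measure_nonneg]) auto
  qed
  show ?thesis
  proof (cases "t1 = t2 \<or> t2 = t3 \<or> t1 = t3")
    case True
    then have "measure lborel (convex hull {c t1, c t2, c t3}) = 0"
      by (auto simp: measure_triangle_eq_wedge wedge.zero_left wedge.zero_right)
    with A_bar_pos show ?thesis by simp
  next
    case False
    then consider "t1 < t2" "t2 < t3" | "t1 < t3" "t3 < t2" | "t2 < t1" "t1 < t3"
      | "t2 < t3" "t3 < t1" | "t3 < t1" "t1 < t2" | "t3 < t2" "t2 < t1"
      by linarith
    then show ?thesis
      by cases (use ordered[of t1 t2 t3] ordered[of t1 t3 t2] ordered[of t2 t1 t3]
        ordered[of t2 t3 t1] ordered[of t3 t1 t2] ordered[of t3 t2 t1] t in
        \<open>simp add: insert_commute\<close>)+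
  qed
qed

end

section \<open>From parameterizations to arcs\<close>

lemma nth_deriv_0: "nth_deriv I 0 c = c"
  by (simp add: nth_deriv_def)

lemma C3_on_has_vector_derivative:
  assumes "C3_on I c" "n < 3" "t \<in> I"
  shows "(nth_deriv I n c has_vector_derivative nth_deriv I (Suc n) c t) (at t within I)"
  using assms vector_derivative_works[of "nth_deriv I n c" "at t within I"]
  by (simp add: C3_on_def nth_deriv_def)

text \<open>Differentiating \<open>c' \<and> c'' = 1\<close> gives \<open>c' \<and> c''' = 0\<close>, so \<open>c'''\<close> is a multiple of the
  nonzero vector \<open>c'\<close>, and the description that defines the curvature denotes the negative of
  that factor.\<close>

lemma affine_frenet:
  assumes unit: "affine_unit_speed I c" and t: "t \<in> interior I"
  shows "nth_deriv I 3 c t = - affine_curvature I c t *\<^sub>R nth_deriv I 1 c t"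
proof -
  let ?c1 = "nth_deriv I 1 c" and ?c2 = "nth_deriv I 2 c" and ?c3 = "nth_deriv I 3 c"
  have C3: "C3_on I c" and one: "\<And>r. r \<in> I \<Longrightarrow> wedge (?c1 r) (?c2 r) = 1"
    using unit by (auto simp: affine_unit_speed_def)
  have tI: "t \<in> I" using t interior_subset by blast
  have d: "(?c1 has_vector_derivative ?c2 t) (at t)" "(?c2 has_vector_derivative ?c3 t) (at t)"
    using C3_on_has_vector_derivative[OF C3 _ tI, of 1] C3_on_has_vector_derivative[OF C3 _ tI, of 2]
    by (simp_all add: at_within_interior[OF t] numeral_2_eq_2 numeral_3_eq_3)
  have "((\<lambda>r. wedge (?c1 r) (?c2 r)) has_real_derivative 0) (at t)"
    by (rule has_field_derivative_transform_within_open[OF DERIV_const[of 1] open_interior t])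
       (use one interior_subset in \<open>metis subsetD\<close>)
  from DERIV_unique[OF this DERIV_wedge[OF d]] have "wedge (?c1 t) (?c3 t) = 0" by simp
  with wedge_expansion[OF one[OF tI], of "?c3 t"]
  have ex: "?c3 t = - (- wedge (?c3 t) (?c2 t)) *\<^sub>R ?c1 t" by simp
  have "?c1 t \<noteq> 0"
  proof
    assume "?c1 t = 0"
    with one[OF tI] show False by (simp add: wedge.zero_left)
  qed
  then have "\<exists>!k. ?c3 t = - k *\<^sub>R ?c1 t"
    using ex by (metis neg_equal_iff_equal scaleR_cancel_right)
  from theI'[OF this] show ?thesis unfolding affine_curvature_def .
qed

lemma traverses_once_embedded:
  assumes "traverses_once I c C" "s \<in> I" "t \<in> interior I" "s \<noteq> t"
  shows "c s \<noteq> c t"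
proof -
  have tI: "t \<in> I" using assms(3) interior_subset by blast
  consider "inj_on c I" | a b where "I = {a..b}" "c a = c b" "inj_on c {a..<b}"
    using assms(1) by (auto simp: traverses_once_def)
  then show ?thesis
  proof cases
    case 1
    with assms tI show ?thesis by (auto dest: inj_onD)
  next
    case 2
    then have t: "a < t" "t < b" using assms(3) by auto
    show ?thesis
    proof (cases "s = b")
      case True
      have "c a \<noteq> c t" using inj_onD[OF 2(3), of a t] t by auto
      with True 2(2) show ?thesis by simp
    next
      case False
      then show ?thesis using inj_onD[OF 2(3), of s t] t assms(2,4) 2(1) by auto
    qed
  qed
qed

lemma convex_affine_arcI:
  assumes param: "affine_unit_speed_param I c C" and front: "C \<subseteq> frontier (convex hull C)"
  shows "convex_affine_arc I c (nth_deriv I 1 c) (nth_deriv I 2 c) (affine_curvature I c)"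
proof -
  have unit: "affine_unit_speed I c" and trav: "traverses_once I c C" and int: "is_interval I"
    using param by (auto simp: affine_unit_speed_param_def)
  have C3: "C3_on I c" using unit by (simp add: affine_unit_speed_def)
  have dI: "(c has_vector_derivative nth_deriv I 1 c t) (at t within I)"
    "(nth_deriv I 1 c has_vector_derivative nth_deriv I 2 c t) (at t within I)"
    "(nth_deriv I 2 c has_vector_derivative nth_deriv I 3 c t) (at t within I)" if "t \<in> I" for t
    using C3_on_has_vector_derivative[OF C3 _ that, of 0] C3_on_has_vector_derivative[OF C3 _ that, of 1]
      C3_on_has_vector_derivative[OF C3 _ that, of 2]
    by (simp_all add: nth_deriv_0 numeral_2_eq_2 numeral_3_eq_3)
  have d: "(c has_vector_derivative nth_deriv I 1 c t) (at t)"
    "(nth_deriv I 1 c has_vector_derivative nth_deriv I 2 c t) (at t)"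
    "(nth_deriv I 2 c has_vector_derivative nth_deriv I 3 c t) (at t)" if "t \<in> interior I" for t
    using dI[of t] at_within_interior[OF that] that interior_subset[of I] by auto
  show ?thesis
  proof
    show "continuous_on I c" "continuous_on I (nth_deriv I 1 c)" "continuous_on I (nth_deriv I 2 c)"
      using dI by (auto intro: continuous_on_vector_derivative)
    show "c ` I \<subseteq> frontier (convex hull (c ` I))"
      using front trav by (simp add: traverses_once_def)
    show "c s \<noteq> c t" if "s \<in> I" "t \<in> interior I" "s \<noteq> t" for s t
      using traverses_once_embedded[OF trav that] .
    show "wedge (nth_deriv I 1 c t) (nth_deriv I 2 c t) = 1" if "t \<in> interior I" for t
      using unit that interior_subset[of I] by (auto simp: affine_unit_speed_def)
    show "(nth_deriv I 2 c has_vector_derivative - affine_curvature I c t *\<^sub>R nth_deriv I 1 c t) (at t)"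
      if "t \<in> interior I" for t
      using d(3)[OF that] by (simp only: affine_frenet[OF unit that])
  qed (use int d in auto)
qed

theorem proposition4p3:
  fixes C :: "(real^2) set" and I :: "real set" and c :: "real \<Rightarrow> real^2"
    and k0 :: real and p1 p2 p3 :: "real^2"
  assumes "convex_curve C"
    and "affine_unit_speed_param I c C"
    and "\<forall>t\<in>I. affine_curvature I c t \<ge> k0"
    and "p1 \<in> C" and "p2 \<in> C" and "p3 \<in> C"
  shows "measure lborel (convex hull {p1, p2, p3}) < A_bar k0 (measure lborel I)"
proof -
  have "C \<subseteq> frontier (convex hull C)" using assms(1) by (simp add: convex_curve_def)
  then interpret convex_affine_arc I c "nth_deriv I 1 c" "nth_deriv I 2 c" "affine_curvature I c"
    using convex_affine_arcI[OF assms(2)] by simp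
  have I: "bounded I" "interior I \<noteq> {}" and C: "c ` I = C"
    using assms(2) by (auto simp: affine_unit_speed_param_def traverses_once_def)
  obtain t1 t2 t3 where t: "t1 \<in> I" "t2 \<in> I" "t3 \<in> I" and "p1 = c t1" "p2 = c t2" "p3 = c t3"
    using assms(4-6) C by blast
  then show ?thesis
    using triangle_area_less[OF I t] assms(3) interior_in by simp
qed

end
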